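(* Let $0<\lambda<2$ and $x\in[0,\infty)$, with coding $\omega_\lambda(x)=x_0x_1x_2\ldots$. Then the left endpoints $m_{x_0\ldots x_n}^\lambda=h_{x_0}\circ h_{x_1}\circ\cdots\circ h_{x_n}(0)$ converge to $x$ as $n\to\infty$. Consequently, if $x_n\neq0$ for infinitely many $n$, and one writes $\omega_\lambda(x)=0^{e_0}a_00^{e_1}a_1\cdots0^{e_\ell}a_\ell\cdots$ with integers $a_i>0$, $e_i\ge0$ (where $0^{e}$ means $e$ consecutive zeros), then $x$ is the limit as $\ell\to\infty$ of the finite $\lambda$-continued fractions $$\left[\!\left[\ \underbrace{e_0+1,1,\ldots,1}_{a_0\text{ terms}},\ \underbrace{e_1+2,1,\ldots,1}_{a_1\text{ terms}},\ \ldots,\ \underbrace{e_\ell+2,1,\ldots,1}_{a_\ell\text{ terms}}\ \right]\!\right]_\lambda .$$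
   Context: Notation for finite $\lambda$-continued fractions: for positive integers $b_1,\ldots,b_p$, $[\![b_1,\ldots,b_p]\!]_\lambda=\cfrac{1}{b_1\lambda-\cfrac{1}{\ddots-\cfrac{1}{b_p\lambda}}}$, i.e. $[\![b_p]\!]_\lambda=\frac1{b_p\lambda}$ and $[\![b_1,b_2,\ldots,b_p]\!]_\lambda=\frac{1}{b_1\lambda-[\![b_2,\ldots,b_p]\!]_\lambda}$. Fix a real number $0<\lambda<2$. Let $h(y)=\frac{1}{\lambda-y}$ and $h_0(y)=\frac{y}{\lambda y+1}$. Define $m_0^\lambda=0$ and, as long as $m_i^\lambda<\lambda$, $m_{i+1}^\lambda=h(m_i^\lambda)$ (so $m_1^\lambda=1/\lambda$). This sequence is increasing and finite: there is an integer $i_\lambda\ge 1$ with $0=m_0^\lambda<m_1^\lambda<\cdots<m_{i_\lambda-1}^\lambda<\lambda\le m_{i_\lambda}^\lambda<\infty$. For $0\le i<i_\lambda$ set $h_{i+1}=h\circ h_i$. Let $I_i^\lambda=[m_i^\lambda,m_{i+1}^\lambda)$ for $0\le i<i_\lambda$ and $I_{i_\lambda}^\lambda=[m_{i_\lambda}^\lambda,\infty)$; these intervals partition $[0,\infty)$. For $i<i_\lambda$, $h_i$ is an increasing bijection from $[0,\infty)$ onto $I_i^\lambda$; $h_{i_\lambda}$ is an increasing bijection from $[0,\ell_\lambda)$ onto $I_{i_\lambda}^\lambda$, where $\ell_\lambda=h_{i_\lambda-1}^{-1}(\lambda)$ if $m_{i_\lambda}^\lambda>\lambda$ and $\ell_\lambda=\infty$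 if $m_{i_\lambda}^\lambda=\lambda$. The map $T_\lambda:[0,\infty)\to[0,\infty)$ is defined by $T_\lambda(x)=h_i^{-1}(x)$ for $x\in I_i^\lambda$. Coding: for $x\in[0,\infty)$, $\omega_\lambda(x)=x_0x_1x_2\ldots$, with $x_n\in\{0,\ldots,i_\lambda\}$ the unique index such that $T_\lambda^n(x)\in I_{x_n}^\lambda$. *)

theory Defs
  imports "HOL-Analysis.Analysis"
begin

text \<open>
  In the equation for \<open>b # c # bs\<close> the library convention \<open>1 / 0 = 0\<close> applies when the
  denominator vanishes. All denominators are positive for the continued fractions that come
  from codings.  The value on the empty list is a dummy.
\<close>

fun lam_cfrac :: "real \<Rightarrow> nat list \<Rightarrow> real" where
  "lam_cfrac lam [] = 0"
| "lam_cfrac lam [b] = 1 / (real b * lam)"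
| "lam_cfrac lam (b # c # bs) = 1 / (real b * lam - lam_cfrac lam (c # bs))"

definition hmap :: "real \<Rightarrow> real \<Rightarrow> real" where
  "hmap lam y = 1 / (lam - y)"

definition branch0 :: "real \<Rightarrow> real \<Rightarrow> real" where
  "branch0 lam y = y / (lam * y + 1)"

text \<open>
  For \<open>0 < lam < 2\<close>, the sequence of the \<open>m\<^sub>i\<close> (\<open>endpt lam i\<close>) stops at the first index with
  \<open>lam \<le> m\<^sub>i\<close>, which is \<open>max_digit lam\<close>, and the maps \<open>h\<^sub>i\<close> (\<open>branch lam i\<close>) exist only up to that
  index.  The values of these total functions beyond it are meaningless and not used.
\<close>

fun endpt :: "real \<Rightarrow> nat \<Rightarrow> real" where
  "endpt lam 0 = 0"
| "endpt lam (Suc i) = hmap lam (endpt lam i)"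

definition max_digit :: "real \<Rightarrow> nat" where
  "max_digit lam = (LEAST i. lam \<le> endpt lam i)"

fun branch :: "real \<Rightarrow> nat \<Rightarrow> real \<Rightarrow> real" where
  "branch lam 0 = branch0 lam"
| "branch lam (Suc i) = hmap lam \<circ> branch lam i"

definition Ival :: "real \<Rightarrow> nat \<Rightarrow> real set" where
  "Ival lam i = (if i < max_digit lam then {endpt lam i..<endpt lam (Suc i)}
                 else {endpt lam (max_digit lam)..})"

definition ell :: "real \<Rightarrow> ereal" where
  "ell lam = (if endpt lam (max_digit lam) = lam then \<infinity>
              else ereal (the_inv_into {0..} (branch lam (max_digit lam - 1)) lam))"

definition domain_of_branch :: "real \<Rightarrow> nat \<Rightarrow> real set" where
  "domain_of_branch lam i = (if i < max_digit lam then {0..} else {y. 0 \<le> y \<and> ereal y < ell lam})"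

definition digit :: "real \<Rightarrow> real \<Rightarrow> nat" where
  "digit lam x = (THE i. i \<le> max_digit lam \<and> x \<in> Ival lam i)"

definition Tmap :: "real \<Rightarrow> real \<Rightarrow> real" where
  "Tmap lam x = the_inv_into (domain_of_branch lam (digit lam x)) (branch lam (digit lam x)) x"

definition coding :: "real \<Rightarrow> real \<Rightarrow> nat \<Rightarrow> nat" where
  "coding lam x n = digit lam ((Tmap lam ^^ n) x)"

definition left_endpoint :: "real \<Rightarrow> nat list \<Rightarrow> real" where
  "left_endpoint lam w = foldr (branch lam) w 0"

text \<open>
  \<open>zero_blocks \<omega> e a\<close> says that the infinite word \<open>\<omega>\<close> is the concatenation of the
  blocks consisting of \<open>e i\<close> zeros followed by the letter \<open>a i > 0\<close>: it begins with every finite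
  concatenation of the blocks.
\<close>

definition block_prefix :: "(nat \<Rightarrow> nat) \<Rightarrow> (nat \<Rightarrow> nat) \<Rightarrow> nat \<Rightarrow> nat list" where
  "block_prefix e a l = concat (map (\<lambda>i. replicate (e i) 0 @ [a i]) [0..<Suc l])"

definition zero_blocks :: "(nat \<Rightarrow> nat) \<Rightarrow> (nat \<Rightarrow> nat) \<Rightarrow> (nat \<Rightarrow> nat) \<Rightarrow> bool" where
  "zero_blocks \<omega> e a \<longleftrightarrow>
     (\<forall>i. a i > 0) \<and>
     (\<forall>l. map \<omega> [0..<length (block_prefix e a l)] = block_prefix e a l)"

definition cfrac_digits :: "(nat \<Rightarrow> nat) \<Rightarrow> (nat \<Rightarrow> nat) \<Rightarrow> nat \<Rightarrow> nat list" where
  "cfrac_digits e a l =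
     concat (map (\<lambda>i. (if i = 0 then e i + 1 else e i + 2) # replicate (a i - 1) 1) [0..<Suc l])"

end

theory Submission
  imports Defs
begin

text \<open>
  The map \<open>hmap lam\<close> is elliptic: since \<open>lam < 2\<close>, it has a pair of conjugate non-real fixed points,
  the roots of \<open>t\<^sup>2 - lam t + 1\<close>. Hence it is an isometry for the length element
  \<open>dt / (t\<^sup>2 - lam t + 1)\<close>, whose primitive is the arctangent \<open>angle\<close>. The whole line has finite
  length for it. The other generator \<open>branch0 lam\<close> pulls this element back to
  \<open>dt / (t\<^sup>2 + lam t + 1)\<close>, so it strictly shortens every interval of \<open>[0, \<infinity>)\<close>. Every branch is
  \<open>branch0 lam\<close> followed by a power of \<open>hmap lam\<close>, so all branches shorten an interval \<open>[p, y]\<close> by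
  the same amount \<open>angle_gain y - angle_gain p\<close>.

  The contraction is not uniform, because the derivative of \<open>branch0 lam\<close> in this length tends to
  \<open>1\<close> at \<open>0\<close> and at \<open>\<infinity>\<close>. However, an interval of length at least \<open>c\<close> cannot be concentrated near
  these two ends, so it loses at least some \<open>d > 0\<close> depending only on \<open>c\<close>
  (\<open>angle_gain_lower_bound\<close>). The interval between the left endpoint of the cylinder of level \<open>n\<close> and
  \<open>x\<close> is the image of an interval of bounded length under \<open>n\<close> branches. If it still has length
  \<open>c\<close>, then all the intermediate images do, so \<open>n d\<close> is at most the total length
  (\<open>left_endpoint_angle_decay\<close>). This bounds \<open>n\<close> and gives the convergence.

  For the second part, \<open>branch0 lam\<close> adds \<open>1\<close> to the first partial quotient of
  \<open>1 / (b lam - y)\<close>, while \<open>hmap lam\<close> prepends a partial quotient \<open>1\<close>. A block \<open>0\<^sup>e a\<close> is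
  the composite of \<open>e\<close> copies of \<open>branch0 lam\<close>, \<open>a\<close> copies of \<open>hmap lam\<close> and one further
  \<open>branch0 lam\<close>, which is absorbed by the next block and turns \<open>e + 1\<close> into \<open>e + 2\<close> there. As
  \<open>branch0 lam 0 = 0\<close>, the continued fractions are exactly the left endpoints of the block prefixes
  (\<open>lam_cfrac_eq_left_endpoint\<close>), a subsequence of the convergent sequence.
\<close>

section \<open>The branches and their domains\<close>

context
  fixes lam :: real
  assumes lam_pos: "0 < lam" and lam_less_2: "lam < 2"
begin

lemma quadratic_ge: "1 - lam\<^sup>2 / 4 \<le> y\<^sup>2 - lam * y + 1"
proof -
  have "0 \<le> (y - lam / 2)\<^sup>2" by simp
  then show ?thesis by (simp add: power2_eq_square algebra_simps)
qed

lemma discriminant_pos: "0 < 1 - lam\<^sup>2 / 4"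
proof -
  have "lam * lam < 2 * 2" using lam_pos lam_less_2 by (intro mult_strict_mono) auto
  then show ?thesis by (simp add: power2_eq_square)
qed

lemma quadratic_pos: "0 < y\<^sup>2 - lam * y + 1"
  using quadratic_ge[of y] discriminant_pos by linarith

text \<open>The increment of the orbit of \<open>0\<close> has a positive lower bound because the discriminant of
  the fixed-point equation of \<open>hmap lam\<close> is negative. This is why the orbit passes \<open>lam\<close>.\<close>

lemma hmap_increment:
  assumes "0 \<le> y" "y < lam"
  shows "y + (1 - lam\<^sup>2 / 4) / lam \<le> hmap lam y"
proof -
  have "(1 - lam\<^sup>2 / 4) / lam \<le> (y\<^sup>2 - lam * y + 1) / (lam - y)"
    using assms quadratic_ge[of y] quadratic_pos[of y] by (intro frac_le) auto
  also have "\<dots> = hmap lam y - y"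
    using assms by (simp add: hmap_def field_simps power2_eq_square)
  finally show ?thesis by simp
qed

lemma hmap_strict_mono: "y < z \<Longrightarrow> z < lam \<Longrightarrow> hmap lam y < hmap lam z"
  by (simp add: hmap_def frac_less2)

lemma hmap_image_atLeast:
  assumes "a < lam"
  shows "hmap lam ` {a..<lam} = {hmap lam a..}"
proof (intro equalityI subsetI)
  fix x assume "x \<in> hmap lam ` {a..<lam}"
  then obtain y where "a \<le> y" "y < lam" "x = hmap lam y" by auto
  then show "x \<in> {hmap lam a..}"
    using hmap_strict_mono[of a y] by (cases "a = y") auto
next
  fix x assume x: "x \<in> {hmap lam a..}"
  have "0 < hmap lam a" using assms by (simp add: hmap_def)
  then have "0 < x" using x by auto
  have "a \<le> lam - 1 / x" "lam - 1 / x < lam"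
    using x assms \<open>0 < x\<close> by (auto simp: hmap_def field_simps)
  moreover have "x = hmap lam (lam - 1 / x)" using \<open>0 < x\<close> by (simp add: hmap_def)
  ultimately show "x \<in> hmap lam ` {a..<lam}" by auto
qed

lemma hmap_image_Ico:
  assumes "a < lam" "b < lam"
  shows "hmap lam ` {a..<b} = {hmap lam a..<hmap lam b}"
proof -
  have sm: "hmap lam y < hmap lam b \<longleftrightarrow> y < b" if "y < lam" for y
    using hmap_strict_mono[of y b] hmap_strict_mono[of b y] that assms(2)
    by (cases y b rule: linorder_cases) auto
  have "{a..<b} = {y \<in> {a..<lam}. y < b}" using assms by auto
  also have "hmap lam ` \<dots> = {x \<in> hmap lam ` {a..<lam}. x < hmap lam b}"
    using sm by auto
  finally show ?thesis using hmap_image_atLeast[OF assms(1)] by auto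
qed

lemma endpt_unbounded: "\<exists>i. lam \<le> endpt lam i"
proof (rule ccontr)
  assume "\<not> ?thesis"
  then have less: "endpt lam i < lam" for i by (auto simp: not_le)
  define c where "c = (1 - lam\<^sup>2 / 4) / lam"
  have "0 < c" using discriminant_pos lam_pos by (simp add: c_def)
  have ge: "real i * c \<le> endpt lam i" for i
  proof (induction i)
    case (Suc i)
    have "0 \<le> endpt lam i" using Suc \<open>0 < c\<close> by (meson mult_nonneg_nonneg of_nat_0_le_iff order.trans less_imp_le)
    then have "endpt lam i + c \<le> endpt lam (Suc i)"
      using hmap_increment[of "endpt lam i"] less[of i] by (simp add: c_def)
    then show ?case using Suc by (simp add: algebra_simps)
  qed simp
  obtain n where "lam < real n * c" using \<open>0 < c\<close> reals_Archimedean3 by blast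
  then show False using ge[of n] less[of n] by linarith
qed

lemma endpt_max_digit: "lam \<le> endpt lam (max_digit lam)"
  unfolding max_digit_def using endpt_unbounded by (rule LeastI_ex)

lemma endpt_less_lam: "i < max_digit lam \<Longrightarrow> endpt lam i < lam"
  unfolding max_digit_def using not_less_Least by (metis not_le)

lemma max_digit_pos: "0 < max_digit lam"
  using endpt_max_digit lam_pos by (cases "max_digit lam") auto

lemma endpt_nonneg: "i \<le> max_digit lam \<Longrightarrow> 0 \<le> endpt lam i"
  by (cases i) (use endpt_less_lam in \<open>auto simp: hmap_def less_imp_le\<close>)

lemma endpt_less_Suc: "i < max_digit lam \<Longrightarrow> endpt lam i < endpt lam (Suc i)"
proof -
  assume i: "i < max_digit lam"
  have "0 < (1 - lam\<^sup>2 / 4) / lam" using discriminant_pos lam_pos by simp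
  then show ?thesis using hmap_increment[of "endpt lam i"] endpt_less_lam[OF i] endpt_nonneg[of i] i by simp
qed

lemma endpt_mono: "i \<le> j \<Longrightarrow> j \<le> max_digit lam \<Longrightarrow> endpt lam i \<le> endpt lam j"
proof (induction j rule: dec_induct)
  case (step n)
  then show ?case using endpt_less_Suc[of n] by simp
qed simp

lemma Ival_disjoint:
  assumes "x \<in> Ival lam i" "x \<in> Ival lam j" "i \<le> max_digit lam" "j \<le> max_digit lam"
  shows "i = j"
proof -
  have less: False if "i < j" "j \<le> max_digit lam" "x \<in> Ival lam i" "x \<in> Ival lam j" for i j
  proof -
    have "endpt lam (Suc i) \<le> endpt lam j" using that by (intro endpt_mono) auto
    moreover have "x < endpt lam (Suc i)" "endpt lam j \<le> x"
      using that by (auto simp: Ival_def split: if_splits)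
    ultimately show False by linarith
  qed
  then show ?thesis using assms less[of i j] less[of j i] by (cases i j rule: linorder_cases) auto
qed

lemma Ival_cover:
  assumes "0 \<le> x"
  obtains i where "i \<le> max_digit lam" "x \<in> Ival lam i"
proof -
  define i where "i = (GREATEST i. i \<le> max_digit lam \<and> endpt lam i \<le> x)"
  have i: "i \<le> max_digit lam \<and> endpt lam i \<le> x"
    unfolding i_def by (rule GreatestI_nat[where k = 0 and b = "max_digit lam"]) (use assms in auto)
  have ub: "j \<le> i" if "j \<le> max_digit lam \<and> endpt lam j \<le> x" for j
    unfolding i_def using that by (intro Greatest_le_nat[where b = "max_digit lam"]) auto
  have "x < endpt lam (Suc i)" if "i < max_digit lam"
    using ub[of "Suc i"] that by (metis Suc_leI Suc_n_not_le_n not_le)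
  then have "x \<in> Ival lam i" using i by (auto simp: Ival_def)
  then show ?thesis using i that by blast
qed

lemma digit_le_max: "0 \<le> x \<Longrightarrow> digit lam x \<le> max_digit lam"
  and Ival_digit: "0 \<le> x \<Longrightarrow> x \<in> Ival lam (digit lam x)"
proof -
  assume "0 \<le> x"
  then obtain i where i: "i \<le> max_digit lam" "x \<in> Ival lam i" by (rule Ival_cover)
  have "digit lam x = i"
    unfolding digit_def using i Ival_disjoint by blast
  then show "digit lam x \<le> max_digit lam" "x \<in> Ival lam (digit lam x)" using i by auto
qed

lemma branch0_bij: "strict_mono_on {0..} (branch0 lam)" "branch0 lam ` {0..} = {0..<1 / lam}"
proof -
  have pos: "0 < lam * y + 1" if "0 \<le> y" for y
    using that lam_pos by (simp add: add_nonneg_pos)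
  show "strict_mono_on {0..} (branch0 lam)"
  proof (rule strict_mono_onI)
    fix y z :: real assume "y \<in> {0..}" "z \<in> {0..}" "y < z"
    then show "branch0 lam y < branch0 lam z"
      using pos[of y] pos[of z] by (simp add: branch0_def divide_simps) (simp add: algebra_simps)
  qed
  show "branch0 lam ` {0..} = {0..<1 / lam}"
  proof (intro equalityI subsetI)
    fix x assume "x \<in> branch0 lam ` {0..}"
    then obtain y where "0 \<le> y" "x = branch0 lam y" by auto
    moreover have "y / (lam * y + 1) < 1 / lam"
      using pos[OF \<open>0 \<le> y\<close>] lam_pos by (simp add: field_simps)
    ultimately show "x \<in> {0..<1 / lam}"
      using pos[OF \<open>0 \<le> y\<close>] by (simp add: branch0_def)
  next
    fix x assume x: "x \<in> {0..<1 / lam}"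
    then have d: "0 < 1 - lam * x" using lam_pos by (simp add: field_simps)
    define y where "y = x / (1 - lam * x)"
    have "lam * y + 1 = 1 / (1 - lam * x)" using d by (simp add: y_def field_simps)
    then have "branch0 lam y = x" using d by (simp add: branch0_def y_def)
    moreover have "0 \<le> y" using x d by (simp add: y_def)
    ultimately show "x \<in> branch0 lam ` {0..}" by force
  qed
qed

lemma branch_below_max:
  assumes "i < max_digit lam"
  shows "strict_mono_on {0..} (branch lam i) \<and> branch lam i ` {0..} = {endpt lam i..<endpt lam (Suc i)}"
  using assms
proof (induction i)
  case 0
  then show ?case using branch0_bij by (simp add: hmap_def)
next
  case (Suc i)
  then have IH: "strict_mono_on {0..} (branch lam i)"
      "branch lam i ` {0..} = {endpt lam i..<endpt lam (Suc i)}" by auto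
  have lt: "endpt lam i < lam" "endpt lam (Suc i) < lam" using Suc.prems by (auto intro!: endpt_less_lam simp del: endpt.simps)
  have "branch lam i y < lam" if "0 \<le> y" for y
    using IH(2) that lt by (metis atLeastLessThan_iff atLeast_iff image_eqI order.strict_trans)
  then have "strict_mono_on {0..} (branch lam (Suc i))"
    using IH(1) by (auto simp: strict_mono_on_def intro!: hmap_strict_mono)
  moreover have "branch lam (Suc i) ` {0..} = {endpt lam (Suc i)..<endpt lam (Suc (Suc i))}"
    using hmap_image_Ico[OF lt] unfolding IH(2)[symmetric]
    by (simp only: branch.simps endpt.simps image_comp)
  ultimately show ?case by (rule conjI)
qed

text \<open>If finite, the number \<open>ell lam\<close> marks the point at which \<open>branch lam (max_digit lam - 1)\<close> reaches the
  pole of \<open>hmap lam\<close>.\<close>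

lemma domain_of_branch_max:
  "domain_of_branch lam (max_digit lam) = {y. 0 \<le> y \<and> branch lam (max_digit lam - 1) y < lam}"
proof -
  define k where "k = max_digit lam - 1"
  have k: "k < max_digit lam" "Suc k = max_digit lam" using max_digit_pos by (auto simp: k_def)
  have sm: "strict_mono_on {0..} (branch lam k)"
    and im: "branch lam k ` {0..} = {endpt lam k..<endpt lam (max_digit lam)}"
    using branch_below_max[OF k(1)] k(2) by auto
  show ?thesis
  proof (cases "endpt lam (max_digit lam) = lam")
    case True
    then have "branch lam k y < lam" if "0 \<le> y" for y using im that by fastforce
    then show ?thesis using True by (auto simp: domain_of_branch_def ell_def k_def)
  next
    case False
    have inj: "inj_on (branch lam k) {0..}" using sm by (rule strict_mono_on_imp_inj_on)
    have "lam \<in> branch lam k ` {0..}"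
      using False endpt_max_digit endpt_less_lam[OF k(1)] by (simp add: im)
    then obtain t where t: "0 \<le> t" "branch lam k t = lam" by auto
    then have "the_inv_into {0..} (branch lam k) lam = t"
      using the_inv_into_f_f[OF inj, of t] by simp
    then have "ell lam = ereal t" using False by (simp add: ell_def k_def)
    moreover have "branch lam k y < lam \<longleftrightarrow> y < t" if "0 \<le> y" for y
      using strict_mono_on_less[OF sm, of y t] that t by simp
    ultimately show ?thesis by (auto simp: domain_of_branch_def k_def)
  qed
qed

lemma branch_bij:
  assumes "i \<le> max_digit lam"
  shows "strict_mono_on (domain_of_branch lam i) (branch lam i)"
    and "branch lam i ` domain_of_branch lam i = Ival lam i"
proof -
  have "strict_mono_on (domain_of_branch lam i) (branch lam i) \<and>
        branch lam i ` domain_of_branch lam i = Ival lam i"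
  proof (cases "i < max_digit lam")
    case True
    then show ?thesis using branch_below_max by (simp add: domain_of_branch_def Ival_def)
  next
    case False
    define k where "k = max_digit lam - 1"
    have k: "k < max_digit lam" "i = Suc k" "Suc k = max_digit lam"
      using max_digit_pos False assms by (auto simp: k_def)
    have sm: "strict_mono_on {0..} (branch lam k)"
      and im: "branch lam k ` {0..} = {endpt lam k..<endpt lam (max_digit lam)}"
      using branch_below_max[OF k(1)] k(3) by auto
    have dom: "domain_of_branch lam i = {y. 0 \<le> y \<and> branch lam k y < lam}"
      using domain_of_branch_max k by (simp add: k_def)
    have "strict_mono_on (domain_of_branch lam i) (branch lam i)"
    proof (rule strict_mono_onI)
      fix y z assume "y \<in> domain_of_branch lam i" "z \<in> domain_of_branch lam i" "y < z"
      then show "branch lam i y < branch lam i z"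
        using strict_mono_onD[OF sm, of y z] by (simp add: dom) (simp add: k(2) hmap_strict_mono)
    qed
    moreover have "branch lam i ` domain_of_branch lam i = Ival lam i"
    proof -
      have "branch lam k ` domain_of_branch lam i = branch lam k ` {0..} \<inter> {..<lam}"
        by (auto simp: dom)
      also have "\<dots> = {endpt lam k..<lam}" using im endpt_max_digit by auto
      finally have "hmap lam ` branch lam k ` domain_of_branch lam i = {hmap lam (endpt lam k)..}"
        using hmap_image_atLeast[OF endpt_less_lam[OF k(1)]] by simp
      moreover have "hmap lam (endpt lam k) = endpt lam (max_digit lam)" using k(3) by (metis endpt.simps(2))
      moreover have "branch lam i ` D = hmap lam ` branch lam k ` D" for D
        by (simp only: k(2) branch.simps image_comp)
      ultimately show ?thesis using k by (simp add: Ival_def)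
    qed
    ultimately show ?thesis by simp
  qed
  then show "strict_mono_on (domain_of_branch lam i) (branch lam i)"
    "branch lam i ` domain_of_branch lam i = Ival lam i" by auto
qed

lemma domain_nonneg: "y \<in> domain_of_branch lam i \<Longrightarrow> 0 \<le> y"
  by (auto simp: domain_of_branch_def split: if_splits)

lemma domain_downward_closed:
  "y \<in> domain_of_branch lam i \<Longrightarrow> 0 \<le> p \<Longrightarrow> p \<le> y \<Longrightarrow> p \<in> domain_of_branch lam i"
  by (auto simp: domain_of_branch_def split: if_splits elim: le_less_trans[rotated])

text \<open>On its domain a branch is a genuine composite of Moebius maps: \<open>hmap lam\<close> is applied only
  to the left of its pole.\<close>

lemma branch_avoids_pole:
  assumes "i \<le> max_digit lam" "j < i" "y \<in> domain_of_branch lam i"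
  shows "0 \<le> branch lam j y" "branch lam j y < lam"
proof -
  have j: "j < max_digit lam" using assms by simp
  have "0 \<le> y" using assms(3) by (rule domain_nonneg)
  then have "branch lam j y \<in> {endpt lam j..<endpt lam (Suc j)}"
    using branch_below_max[OF j] by blast
  then have in_j: "endpt lam j \<le> branch lam j y" "branch lam j y < endpt lam (Suc j)" by auto
  show "0 \<le> branch lam j y" using in_j(1) endpt_nonneg[of j] j by simp
  show "branch lam j y < lam"
  proof (cases "Suc j < max_digit lam")
    case True
    then show ?thesis using in_j(2) endpt_less_lam[OF True] by linarith
  next
    case False
    then have "i = max_digit lam" "j = max_digit lam - 1" using assms by auto
    then show ?thesis using assms(3) domain_of_branch_max by auto
  qed
qed

lemma branch_nonneg:
  assumes "i \<le> max_digit lam" "y \<in> domain_of_branch lam i"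
  shows "0 \<le> branch lam i y"
proof -
  have "branch lam i y \<in> Ival lam i" using branch_bij(2)[OF assms(1)] assms(2) by blast
  then show ?thesis
    using endpt_nonneg[of i] endpt_nonneg[of "max_digit lam"] assms(1)
    by (auto simp: Ival_def split: if_splits)
qed

lemma Tmap_in_domain: "0 \<le> x \<Longrightarrow> Tmap lam x \<in> domain_of_branch lam (digit lam x)"
  and branch_Tmap: "0 \<le> x \<Longrightarrow> branch lam (digit lam x) (Tmap lam x) = x"
proof -
  assume x: "0 \<le> x"
  note bij = branch_bij[OF digit_le_max[OF x]]
  have inj: "inj_on (branch lam (digit lam x)) (domain_of_branch lam (digit lam x))"
    using bij(1) by (rule strict_mono_on_imp_inj_on)
  have mem: "x \<in> branch lam (digit lam x) ` domain_of_branch lam (digit lam x)"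
    using Ival_digit[OF x] bij(2) by simp
  show "Tmap lam x \<in> domain_of_branch lam (digit lam x)"
    unfolding Tmap_def by (rule the_inv_into_into[OF inj mem]) simp
  show "branch lam (digit lam x) (Tmap lam x) = x"
    unfolding Tmap_def by (rule f_the_inv_into_f[OF inj mem])
qed

lemma Tmap_nonneg: "0 \<le> x \<Longrightarrow> 0 \<le> Tmap lam x"
  using Tmap_in_domain domain_nonneg by blast

text \<open>The coding of the shifted orbit supports inductions on the length of the prefix with varying
  starting point.\<close>

lemma coding_prefix_Suc:
  "map (coding lam x) [0..<Suc n] = digit lam x # map (coding lam (Tmap lam x)) [0..<n]"
proof -
  have "[0..<Suc n] = 0 # map Suc [0..<n]"
    by (metis map_Suc_upt upt_conv_Cons zero_less_Suc)
  then show ?thesis by (simp add: coding_def funpow_swap1 del: upt_Suc)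
qed

lemma left_endpoint_bounds:
  assumes "0 \<le> x"
  shows "0 \<le> left_endpoint lam (map (coding lam x) [0..<n])
       \<and> left_endpoint lam (map (coding lam x) [0..<n]) \<le> x"
  using assms
proof (induction n arbitrary: x)
  case 0
  then show ?case by (simp add: left_endpoint_def)
next
  case (Suc n)
  define y where "y = Tmap lam x"
  define q where "q = left_endpoint lam (map (coding lam y) [0..<n])"
  have q: "0 \<le> q" "q \<le> y"
    using Suc.IH[of y] Tmap_nonneg[OF Suc.prems] by (auto simp: q_def y_def)
  have y: "y \<in> domain_of_branch lam (digit lam x)"
    using Tmap_in_domain[OF Suc.prems] by (simp add: y_def)
  have qd: "q \<in> domain_of_branch lam (digit lam x)" using domain_downward_closed[OF y q] .
  have "branch lam (digit lam x) q \<le> branch lam (digit lam x) y"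
    using strict_mono_on_leD[OF branch_bij(1)[OF digit_le_max[OF Suc.prems]]] y qd q by blast
  then show ?case
    using branch_nonneg[OF digit_le_max[OF Suc.prems] qd] branch_Tmap[OF Suc.prems]
    unfolding coding_prefix_Suc by (simp add: left_endpoint_def q_def y_def)
qed

section \<open>The rotation-invariant length\<close>

text \<open>A primitive of \<open>1 / (t\<^sup>2 - lam t + 1)\<close>. Up to a constant factor it measures arcs on the circle on
  which \<open>hmap lam\<close> acts as a rotation.\<close>

definition angle :: "real \<Rightarrow> real" where
  "angle x = arctan ((x - lam / 2) / sqrt (1 - lam\<^sup>2 / 4)) / sqrt (1 - lam\<^sup>2 / 4)"

definition angle_gain :: "real \<Rightarrow> real" where
  "angle_gain y = angle y - angle (branch0 lam y)"

lemma angle_deriv: "(angle has_real_derivative 1 / (x\<^sup>2 - lam * x + 1)) (at x)"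
proof -
  define s where "s = sqrt (1 - lam\<^sup>2 / 4)"
  have s: "0 < s" "s\<^sup>2 = 1 - lam\<^sup>2 / 4" using discriminant_pos by (simp_all add: s_def)
  have "((\<lambda>x. arctan ((x - lam / 2) / s) / s) has_real_derivative
          (1 / s) * inverse (1 + ((x - lam / 2) / s)\<^sup>2) / s) (at x)"
    using s(1) by (auto intro!: derivative_eq_intros)
  moreover have "(1 / s) * inverse (1 + (u / s)\<^sup>2) / s = 1 / (s\<^sup>2 + u\<^sup>2)" for u
  proof -
    have "1 + (u / s)\<^sup>2 = (s\<^sup>2 + u\<^sup>2) / s\<^sup>2" using s(1) by (simp add: power_divide add_divide_distrib)
    then show ?thesis using s(1) by (simp add: power2_eq_square)
  qed
  moreover have "s\<^sup>2 + (x - lam / 2)\<^sup>2 = x\<^sup>2 - lam * x + 1"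
    unfolding s(2) by (simp add: power2_eq_square field_simps)
  ultimately show ?thesis unfolding angle_def s_def by simp
qed

lemma angle_mono: "x \<le> y \<Longrightarrow> angle x \<le> angle y"
  by (rule DERIV_nonneg_imp_nondecreasing) (use angle_deriv quadratic_pos in \<open>auto intro!: exI less_imp_le\<close>)

text \<open>With \<open>z = hmap lam y\<close> one has
  \<open>(z\<^sup>2 - lam z + 1) (lam - y)\<^sup>2 = y\<^sup>2 - lam y + 1\<close>, which is the invariance of the length
  element under \<open>hmap lam\<close>.\<close>

lemma angle_hmap_deriv:
  assumes "y < lam"
  shows "((\<lambda>y. angle (hmap lam y)) has_real_derivative 1 / (y\<^sup>2 - lam * y + 1)) (at y)"
proof -
  define z where "z = hmap lam y"
  have "(hmap lam has_real_derivative 1 / (lam - y)\<^sup>2) (at y)"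
    unfolding hmap_def using assms by (auto intro!: derivative_eq_intros simp: power2_eq_square)
  from DERIV_chain2[OF angle_deriv this]
  have "((\<lambda>y. angle (hmap lam y)) has_real_derivative
      1 / (z\<^sup>2 - lam * z + 1) * (1 / (lam - y)\<^sup>2)) (at y)" by (simp add: z_def)
  moreover have "(z\<^sup>2 - lam * z + 1) * (lam - y)\<^sup>2 = y\<^sup>2 - lam * y + 1"
  proof -
    have "z * (lam - y) = 1" using assms by (simp add: z_def hmap_def)
    then show ?thesis by algebra
  qed
  ultimately show ?thesis by simp
qed

lemma angle_hmap_diff:
  assumes "p \<le> y" "y < lam"
  shows "angle (hmap lam y) - angle (hmap lam p) = angle y - angle p"
proof (cases "p = y")
  case False
  define g where "g t = angle (hmap lam t) - angle t" for t
  have D: "(g has_real_derivative 0) (at t)" if "t \<le> y" for t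
    using DERIV_diff[OF angle_hmap_deriv angle_deriv, of t] that assms
    by (simp add: g_def[abs_def])
  have "g y = g p"
  proof (rule DERIV_isconst_end[where f = g and a = p and b = y])
    show "p < y" using False assms by simp
    show "continuous_on {p..y} g"
      using D by (intro continuous_at_imp_continuous_on ballI) (auto intro: DERIV_isCont)
    show "\<And>t. p < t \<Longrightarrow> t < y \<Longrightarrow> (g has_real_derivative 0) (at t)"
      using D by simp
  qed
  then show ?thesis by (simp add: g_def)
qed simp

text \<open>The pullback of the length element under \<open>branch0 lam\<close> is \<open>dy / (y\<^sup>2 + lam y + 1)\<close>. The
  first factor below is the relative loss of length. It vanishes only at \<open>0\<close> and in the limit at
  \<open>\<infinity>\<close>.\<close>

lemma angle_gain_deriv:
  assumes "0 \<le> y"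
  shows "(angle_gain has_real_derivative
           (2 * lam * y / (y\<^sup>2 + lam * y + 1)) * (1 / (y\<^sup>2 - lam * y + 1))) (at y)"
proof -
  define z where "z = branch0 lam y"
  have d: "0 < lam * y + 1" using assms lam_pos by (simp add: add_nonneg_pos)
  have Q: "0 < y\<^sup>2 + lam * y + 1" using assms lam_pos by (simp add: add_nonneg_pos)
  have "(branch0 lam has_real_derivative 1 / (lam * y + 1)\<^sup>2) (at y)"
    unfolding branch0_def using d
    by (auto intro!: derivative_eq_intros simp: power2_eq_square)
  from DERIV_diff[OF angle_deriv DERIV_chain2[OF angle_deriv this]]
  have "(angle_gain has_real_derivative 1 / (y\<^sup>2 - lam * y + 1)
      - 1 / (z\<^sup>2 - lam * z + 1) * (1 / (lam * y + 1)\<^sup>2)) (at y)"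
    by (simp add: z_def angle_gain_def[abs_def])
  moreover have "(z\<^sup>2 - lam * z + 1) * (lam * y + 1)\<^sup>2 = y\<^sup>2 + lam * y + 1"
  proof -
    have "z * (lam * y + 1) = y" using d by (simp add: z_def branch0_def)
    moreover have "(z\<^sup>2 - lam * z + 1) * D\<^sup>2 = (z * D)\<^sup>2 - lam * (z * D) * D + D\<^sup>2" for D
      by (simp add: power2_eq_square algebra_simps)
    ultimately have "(z\<^sup>2 - lam * z + 1) * (lam * y + 1)\<^sup>2
        = y\<^sup>2 - lam * y * (lam * y + 1) + (lam * y + 1)\<^sup>2" by simp
    then show ?thesis by (simp add: power2_eq_square algebra_simps)
  qed
  moreover have "1 / (y\<^sup>2 - lam * y + 1) - 1 / (y\<^sup>2 + lam * y + 1)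
      = (2 * lam * y / (y\<^sup>2 + lam * y + 1)) * (1 / (y\<^sup>2 - lam * y + 1))"
    using Q quadratic_pos[of y] by (simp add: divide_simps)
  ultimately show ?thesis by simp
qed

lemma angle_gain_mono:
  assumes "0 \<le> p" "p \<le> y"
  shows "angle_gain p \<le> angle_gain y"
proof (rule DERIV_nonneg_imp_nondecreasing[OF assms(2)])
  fix t assume "p \<le> t" "t \<le> y"
  then have t: "0 \<le> t" using assms by simp
  have "0 \<le> (2 * lam * t / (t\<^sup>2 + lam * t + 1)) * (1 / (t\<^sup>2 - lam * t + 1))"
    using t lam_pos quadratic_pos[of t] by (intro mult_nonneg_nonneg divide_nonneg_nonneg) auto
  then show "\<exists>D. (angle_gain has_real_derivative D) (at t) \<and> 0 \<le> D"
    using angle_gain_deriv[OF t] by blast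
qed

text \<open>Since \<open>[0, \<infinity>)\<close> has finite length, one can cut off neighbourhoods \<open>[0, e]\<close> and \<open>[M, \<infinity>)\<close> of
  the two neutral points, each of length at most \<open>c / 4\<close>. A remaining part of length at least \<open>c / 2\<close>
  lies in \<open>[e, M]\<close>, where the relative loss is bounded below by a constant \<open>\<kappa>\<close>.\<close>

lemma angle_gain_lower_bound:
  assumes "0 < c"
  obtains d where "0 < d"
    "\<And>p y. 0 \<le> p \<Longrightarrow> p \<le> y \<Longrightarrow> c \<le> angle y - angle p \<Longrightarrow> d \<le> angle_gain y - angle_gain p"
proof -
  define s where "s = sqrt (1 - lam\<^sup>2 / 4)"
  have s: "0 < s" using discriminant_pos by (simp add: s_def)
  have "isCont angle 0" using angle_deriv DERIV_isCont by blast
  then have "(angle \<longlongrightarrow> angle 0) (at_right 0)" 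
    by (simp add: isCont_def filterlim_at_split)
  then have "eventually (\<lambda>e. angle e < angle 0 + c / 4) (at_right 0)"
    by (rule order_tendstoD) (use assms in simp)
  then obtain e where e: "0 < e" "angle e < angle 0 + c / 4"
    using eventually_happens'[OF trivial_limit_at_right_real, OF eventually_conj, OF _ eventually_at_right_less]
    by blast
  have "filterlim (\<lambda>x. (x - lam / 2) / s) at_top at_top"
    using filterlim_tendsto_pos_mult_at_top[OF tendsto_const _
        filterlim_tendsto_add_at_top[OF tendsto_const filterlim_ident], of "1 / s" "- (lam / 2)"] s
    by simp
  then have "(angle \<longlongrightarrow> (pi / 2) / s) at_top"
    unfolding angle_def[abs_def] s_def[symmetric] using s
    by (intro tendsto_divide filterlim_compose[OF tendsto_arctan_at_top]) auto
  then have "eventually (\<lambda>M. (pi / 2) / s - c / 4 < angle M) at_top"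
    by (rule order_tendstoD) (use assms in simp)
  then obtain M where M: "e < M" "(pi / 2) / s - c / 4 < angle M"
    using eventually_happens'[OF trivial_limit_at_top_linorder, OF eventually_conj, OF _ eventually_gt_at_top]
    by blast
  have angle_ub: "angle y < (pi / 2) / s" for y
    using s arctan_ubound unfolding angle_def s_def[symmetric] by (intro divide_strict_right_mono)
  define \<kappa> where "\<kappa> = 2 * lam * e / (M\<^sup>2 + lam * M + 1)"
  have "0 < M\<^sup>2 + lam * M + 1" using lam_pos e M by (intro add_pos_pos) auto
  then have \<kappa>: "0 < \<kappa>" using lam_pos e by (simp add: \<kappa>_def)
  have gain_mid: "\<kappa> * (angle z - angle p) \<le> angle_gain z - angle_gain p"
    if "e \<le> p" "p \<le> z" "z \<le> M" for p z
  proof -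
    have "angle_gain p - \<kappa> * angle p \<le> angle_gain z - \<kappa> * angle z"
    proof (rule DERIV_nonneg_imp_nondecreasing[OF \<open>p \<le> z\<close>])
      fix t assume "p \<le> t" "t \<le> z"
      then have t: "e \<le> t" "t \<le> M" "0 \<le> t" using that e by auto
      have "t\<^sup>2 + lam * t + 1 \<le> M\<^sup>2 + lam * M + 1"
        using t lam_pos by (intro add_mono power_mono mult_left_mono) auto
      moreover have "0 < t\<^sup>2 + lam * t + 1" using t lam_pos by (simp add: add_nonneg_pos)
      ultimately have "\<kappa> \<le> 2 * lam * t / (t\<^sup>2 + lam * t + 1)"
        unfolding \<kappa>_def using t lam_pos e by (intro frac_le mult_left_mono) auto
      then have "0 \<le> (2 * lam * t / (t\<^sup>2 + lam * t + 1)) * (1 / (t\<^sup>2 - lam * t + 1)) - \<kappa> * (1 / (t\<^sup>2 - lam * t + 1))"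
        using mult_right_mono[of \<kappa> _ "1 / (t\<^sup>2 - lam * t + 1)"] quadratic_pos[of t]
        unfolding diff_ge_0_iff_ge by (simp del: times_divide_eq_right times_divide_eq_left mult_1_right)
      moreover have "((\<lambda>t. angle_gain t - \<kappa> * angle t) has_real_derivative
          (2 * lam * t / (t\<^sup>2 + lam * t + 1)) * (1 / (t\<^sup>2 - lam * t + 1)) - \<kappa> * (1 / (t\<^sup>2 - lam * t + 1))) (at t)"
        by (intro DERIV_diff angle_gain_deriv DERIV_cmult angle_deriv t)
      ultimately show "\<exists>D. ((\<lambda>t. angle_gain t - \<kappa> * angle t) has_real_derivative D) (at t) \<and> 0 \<le> D"
        by blast
    qed
    then show ?thesis by (simp add: algebra_simps)
  qed
  show ?thesis
  proof (rule that)
    show "0 < \<kappa> * (c / 2)" using \<kappa> assms by simp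
    fix p y assume py: "0 \<le> p" "p \<le> y" "c \<le> angle y - angle p"
    define p' y' where "p' = max p e" and "y' = min y M"
    have p': "angle p' \<le> angle p + c / 4"
      using e py(1) angle_mono[of 0 p] assms by (auto simp: p'_def max_def)
    have y': "angle y - c / 4 \<le> angle y'"
      using M angle_ub[of y] assms by (auto simp: y'_def min_def)
    have len: "c / 2 \<le> angle y' - angle p'" using p' y' py(3) by linarith
    then have "p' \<le> y'" using angle_mono[of y' p'] assms by (cases "p' \<le> y'") auto
    have "\<kappa> * (c / 2) \<le> \<kappa> * (angle y' - angle p')" using len \<kappa> by simp
    also have "\<dots> \<le> angle_gain y' - angle_gain p'"
      using gain_mid[of p' y'] \<open>p' \<le> y'\<close> by (simp add: p'_def y'_def)
    also have "\<dots> \<le> angle_gain y - angle_gain p"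
      using angle_gain_mono[of p p'] angle_gain_mono[of y' y] \<open>p' \<le> y'\<close> py e
      by (simp add: p'_def y'_def)
    finally show "\<kappa> * (c / 2) \<le> angle_gain y - angle_gain p" .
  qed
qed

text \<open>The loss is the same for all \<open>i\<close>: it comes from the innermost map \<open>branch0 lam\<close>, and the
  copies of \<open>hmap lam\<close> applied afterwards preserve the length.\<close>

lemma angle_branch_diff:
  assumes "i \<le> max_digit lam" "y \<in> domain_of_branch lam i" "0 \<le> p" "p \<le> y"
  shows "angle (branch lam i y) - angle (branch lam i p)
       = (angle y - angle p) - (angle_gain y - angle_gain p)"
proof -
  have "angle (branch lam j y) - angle (branch lam j p)
       = (angle y - angle p) - (angle_gain y - angle_gain p)" if "j \<le> i" for j
    using that
  proof (induction j)
    case 0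
    then show ?case by (simp add: angle_gain_def)
  next
    case (Suc j)
    have j: "j < max_digit lam" "j < i" using Suc.prems assms(1) by auto
    have "branch lam j p \<le> branch lam j y"
      using strict_mono_on_leD[of "{0..}" "branch lam j" p y] branch_below_max[OF j(1)] assms by auto
    then show ?case
      using angle_hmap_diff branch_avoids_pole(2)[OF assms(1) j(2) assms(2)] Suc by simp
  qed
  then show ?thesis by simp
qed

text \<open>Branches do not increase lengths, so an interval that still has length \<open>c\<close> after all of
  them had at least that length before each of them and lost at least \<open>d\<close> every time. The total
  length of the line is \<open>pi / sqrt (1 - lam\<^sup>2 / 4)\<close>.\<close>

lemma left_endpoint_angle_decay:
  assumes step: "\<And>p y. 0 \<le> p \<Longrightarrow> p \<le> y \<Longrightarrow> c \<le> angle y - angle p \<Longrightarrow> d \<le> angle_gain y - angle_gain p"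
    and "0 \<le> x" "c \<le> angle x - angle (left_endpoint lam (map (coding lam x) [0..<n]))"
  shows "angle x - angle (left_endpoint lam (map (coding lam x) [0..<n]))
    \<le> pi / sqrt (1 - lam\<^sup>2 / 4) - real n * d"
  using assms(2,3)
proof (induction n arbitrary: x)
  case 0
  define s where "s = sqrt (1 - lam\<^sup>2 / 4)"
  have s: "0 < s" using discriminant_pos by (simp add: s_def)
  have "arctan u / s - arctan v / s \<le> pi / s" for u v
    using s arctan_bounded[of u] arctan_bounded[of v]
    by (simp add: diff_divide_distrib[symmetric] divide_right_mono)
  then show ?case by (simp add: angle_def s_def)
next
  case (Suc n)
  define y where "y = Tmap lam x"
  define q where "q = left_endpoint lam (map (coding lam y) [0..<n])"
  have y0: "0 \<le> y" using Tmap_nonneg[OF Suc.prems(1)] by (simp add: y_def)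
  have q: "0 \<le> q" "q \<le> y" using left_endpoint_bounds[OF y0] by (auto simp: q_def)
  have "angle (branch lam (digit lam x) y) - angle (branch lam (digit lam x) q)
       = (angle y - angle q) - (angle_gain y - angle_gain q)"
    using Tmap_in_domain[OF Suc.prems(1)] q
    by (intro angle_branch_diff digit_le_max Suc.prems) (auto simp: y_def)
  moreover have "branch lam (digit lam x) y = x" using branch_Tmap[OF Suc.prems(1)] by (simp add: y_def)
  moreover have E: "left_endpoint lam (map (coding lam x) [0..<Suc n]) = branch lam (digit lam x) q"
    unfolding coding_prefix_Suc by (simp add: left_endpoint_def q_def y_def)
  ultimately have diff: "angle x - angle (left_endpoint lam (map (coding lam x) [0..<Suc n]))
      = (angle y - angle q) - (angle_gain y - angle_gain q)" by simp
  have "c \<le> angle y - angle q"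
    using diff Suc.prems(2) angle_gain_mono[OF q] by linarith
  then have "angle y - angle q \<le> pi / sqrt (1 - lam\<^sup>2 / 4) - real n * d"
    and "d \<le> angle_gain y - angle_gain q"
    using Suc.IH[OF y0] step[OF q] by (auto simp: q_def)
  then show ?case unfolding diff by (simp add: algebra_simps)
qed

lemma left_endpoint_tendsto:
  assumes "0 \<le> x"
  shows "(\<lambda>n. left_endpoint lam (map (coding lam x) [0..<n])) \<longlonglongrightarrow> x"
proof (rule order_tendstoI)
  fix a assume "x < a"
  then show "\<forall>\<^sub>F n in sequentially. left_endpoint lam (map (coding lam x) [0..<n]) < a"
    using left_endpoint_bounds[OF assms] by (intro always_eventually) (auto intro: le_less_trans)
next
  fix a assume "a < x"
  define c where "c = angle x - angle a"
  have "angle a < angle x"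
    using \<open>a < x\<close> by (rule DERIV_pos_imp_increasing) (use angle_deriv quadratic_pos in \<open>auto intro!: exI\<close>)
  then have "0 < c" by (simp add: c_def)
  then obtain d where d: "0 < d"
    "\<And>p y. 0 \<le> p \<Longrightarrow> p \<le> y \<Longrightarrow> c \<le> angle y - angle p \<Longrightarrow> d \<le> angle_gain y - angle_gain p"
    using angle_gain_lower_bound by metis
  obtain N where N: "pi / sqrt (1 - lam\<^sup>2 / 4) < real N * d" using d(1) reals_Archimedean3 by blast
  have "a < left_endpoint lam (map (coding lam x) [0..<n])" if "N \<le> n" for n
  proof (rule ccontr)
    let ?p = "left_endpoint lam (map (coding lam x) [0..<n])"
    assume "\<not> a < ?p"
    then have "c \<le> angle x - angle ?p" using angle_mono[of ?p a] by (simp add: c_def)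
    then have "angle x - angle ?p \<le> pi / sqrt (1 - lam\<^sup>2 / 4) - real n * d"
      by (intro left_endpoint_angle_decay[where c = c and d = d] d(2) assms)
    then have "c \<le> pi / sqrt (1 - lam\<^sup>2 / 4) - real n * d"
      using \<open>c \<le> angle x - angle ?p\<close> by linarith
    moreover have "real N * d \<le> real n * d" using that d(1) by simp
    ultimately show False using N \<open>0 < c\<close> by linarith
  qed
  then show "\<forall>\<^sub>F n in sequentially. a < left_endpoint lam (map (coding lam x) [0..<n])"
    using eventually_sequentially by blast
qed

section \<open>From codings to continued fractions\<close>

text \<open>Every branch along the word must be applied within its domain: at the pole of \<open>hmap lam\<close>, where
  division by zero gives \<open>0\<close>, the translation of branches into partial quotients breaks down.\<close>

primrec admissible :: "nat list \<Rightarrow> bool" where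
  "admissible [] = True"
| "admissible (i # v) \<longleftrightarrow>
     i \<le> max_digit lam \<and> left_endpoint lam v \<in> domain_of_branch lam i \<and> admissible v"

lemma admissible_appendD: "admissible (u @ v) \<Longrightarrow> admissible v"
  by (induction u) auto

lemma admissible_coding_prefix:
  assumes "0 \<le> x"
  shows "admissible (map (coding lam x) [0..<n])"
  using assms
proof (induction n arbitrary: x)
  case 0
  then show ?case by simp
next
  case (Suc n)
  note T = Tmap_nonneg[OF Suc.prems]
  show ?case
    unfolding coding_prefix_Suc admissible.simps
    using Suc.IH[OF T] digit_le_max[OF Suc.prems] left_endpoint_bounds[OF T]
      domain_downward_closed[OF Tmap_in_domain[OF Suc.prems]] by blast
qed

definition cf_step :: "nat \<Rightarrow> real \<Rightarrow> real" where
  "cf_step b y = 1 / (real b * lam - y)"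

text \<open>Ending the fold with the tail \<open>0\<close> reproduces the value at a single partial quotient, and the
  dummy value \<open>0\<close> on the empty list makes the equation hold there too.\<close>

lemma lam_cfrac_eq_foldr: "lam_cfrac lam bs = foldr cf_step bs 0"
  by (induction bs rule: induct_list012) (simp_all add: cf_step_def)

lemma branch_eq_foldr: "branch lam a y = foldr cf_step (replicate a 1) (branch0 lam y)"
  by (induction a) (simp_all add: cf_step_def hmap_def)

text \<open>In the coordinate \<open>1 / y\<close> the map \<open>branch0 lam\<close> is the translation by \<open>lam\<close>.\<close>

lemma branch0_cf_step:
  assumes "y < lam" "0 < b"
  shows "branch0 lam (cf_step b y) = cf_step (Suc b) y"
proof -
  have "1 * lam \<le> real b * lam" using assms lam_pos by (intro mult_right_mono) auto
  then have "0 < real b * lam - y" using assms by linarith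
  then show ?thesis
    using lam_pos by (simp add: branch0_def cf_step_def divide_simps) (simp add: algebra_simps)
qed

lemma branch0_funpow_branch:
  assumes "0 < a" "a \<le> max_digit lam" "y \<in> domain_of_branch lam a"
  shows "(branch0 lam ^^ e) (branch lam a y)
       = foldr cf_step ((e + 1) # replicate (a - 1) 1) (branch0 lam y)"
proof -
  have less: "branch lam (a - 1) y < lam"
    using branch_avoids_pole(2)[OF assms(2) _ assms(3)] assms(1) by simp
  have "branch lam a y = cf_step 1 (branch lam (a - 1) y)"
    using assms(1) by (cases a) (simp_all add: cf_step_def hmap_def)
  then have "(branch0 lam ^^ e) (branch lam a y) = cf_step (e + 1) (branch lam (a - 1) y)"
    using less by (induction e) (simp_all add: branch0_cf_step)
  then show ?thesis by (simp add: branch_eq_foldr)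
qed

text \<open>The innermost \<open>branch0 lam\<close> of the letter \<open>a\<close> is left standing before the rest of the word, to be
  merged with the zeros that follow.\<close>

lemma left_endpoint_block:
  assumes "0 < a" "admissible (a # w)"
  shows "left_endpoint lam (replicate e 0 @ a # w)
       = foldr cf_step ((e + 1) # replicate (a - 1) 1) (branch0 lam (left_endpoint lam w))"
proof -
  have "left_endpoint lam (replicate e 0 @ v) = (branch0 lam ^^ e) (left_endpoint lam v)" for v
    by (induction e) (simp_all add: left_endpoint_def)
  moreover have "left_endpoint lam (a # w) = branch lam a (left_endpoint lam w)"
    by (simp add: left_endpoint_def)
  ultimately show ?thesis
    using branch0_funpow_branch[OF assms(1)] assms(2) by simp
qed

text \<open>The outer \<open>branch0 lam\<close> is the one left over by the block before \<open>js\<close>. It acts as one more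
  zero, whence \<open>e i + 2\<close>.\<close>

lemma branch0_left_endpoint_blocks:
  assumes "\<And>i. 0 < a i" "admissible (concat (map (\<lambda>i. replicate (e i) 0 @ [a i]) js))"
  shows "branch0 lam (left_endpoint lam (concat (map (\<lambda>i. replicate (e i) 0 @ [a i]) js)))
       = foldr cf_step (concat (map (\<lambda>i. (e i + 2) # replicate (a i - 1) 1) js)) 0"
  using assms(2)
proof (induction js)
  case Nil
  then show ?case by (simp add: left_endpoint_def branch0_def)
next
  case (Cons j js)
  define w where "w = concat (map (\<lambda>i. replicate (e i) 0 @ [a i]) js)"
  have adm: "admissible (a j # w)"
    by (rule admissible_appendD[of "replicate (e j) 0"]) (use Cons.prems in \<open>simp add: w_def\<close>)
  then have "admissible w" by simp
  have "branch0 lam (left_endpoint lam (replicate (e j) 0 @ a j # w))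
      = left_endpoint lam (replicate (Suc (e j)) 0 @ a j # w)"
    by (simp add: left_endpoint_def)
  also have "\<dots> = foldr cf_step ((Suc (e j) + 1) # replicate (a j - 1) 1) (branch0 lam (left_endpoint lam w))"
    by (rule left_endpoint_block[OF assms(1) adm])
  also have "branch0 lam (left_endpoint lam w)
      = foldr cf_step (concat (map (\<lambda>i. (e i + 2) # replicate (a i - 1) 1) js)) 0"
    using Cons.IH \<open>admissible w\<close> by (simp add: w_def)
  finally show ?case by (simp add: w_def)
qed

lemma lam_cfrac_eq_left_endpoint:
  assumes "\<And>i. 0 < a i" "admissible (block_prefix e a l)"
  shows "lam_cfrac lam (cfrac_digits e a l) = left_endpoint lam (block_prefix e a l)"
proof -
  define js where "js = [1..<Suc l]"
  have js: "[0..<Suc l] = 0 # js" "0 \<notin> set js"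
    unfolding js_def using upt_conv_Cons[of 0 "Suc l"] by auto
  define w where "w = concat (map (\<lambda>i. replicate (e i) 0 @ [a i]) js)"
  have bp: "block_prefix e a l = replicate (e 0) 0 @ a 0 # w"
    unfolding block_prefix_def js(1) by (simp add: w_def)
  have tail: "map (\<lambda>i. (if i = 0 then e i + 1 else e i + 2) # replicate (a i - 1) 1) js
      = map (\<lambda>i. (e i + 2) # replicate (a i - 1) 1) js"
    using js(2) by (auto intro!: gr0I)
  have cd: "cfrac_digits e a l = ((e 0 + 1) # replicate (a 0 - 1) 1)
      @ concat (map (\<lambda>i. (e i + 2) # replicate (a i - 1) 1) js)"
    unfolding cfrac_digits_def js(1) list.map concat.simps tail by simp
  have adm: "admissible (a 0 # w)" using assms(2) unfolding bp by (rule admissible_appendD)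
  then have "admissible w" by simp
  then show ?thesis
    unfolding bp cd lam_cfrac_eq_foldr foldr_append left_endpoint_block[OF assms(1) adm]
    using branch0_left_endpoint_blocks[of a e js] assms(1) by (simp add: w_def)
qed

end

lemma length_block_prefix_ge: "l \<le> length (block_prefix e a l)"
proof -
  have "length js \<le> length (concat (map (\<lambda>i. replicate (e i) 0 @ [a i]) js))" for js :: "nat list"
    by (induction js) auto
  from this[of "[0..<Suc l]"] show ?thesis by (simp add: block_prefix_def del: upt_Suc)
qed

lemma block_prefix_Suc:
  "block_prefix e a (Suc l) = block_prefix e a l @ replicate (e (Suc l)) 0 @ [a (Suc l)]"
  by (simp add: block_prefix_def)

text \<open>The blocks end at the successive positions of the nonzero letters.\<close>

lemma zero_blocks_exist:
  assumes "infinite {n. \<omega> n \<noteq> (0 :: nat)}"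
  shows "\<exists>e a. zero_blocks \<omega> e a"
proof -
  define S where "S = {n. \<omega> n \<noteq> 0}"
  have S: "infinite S" using assms by (simp add: S_def)
  define t where "t = enumerate S"
  define a where "a = (\<lambda>i. \<omega> (t i))"
  define e where "e = (\<lambda>i. case i of 0 \<Rightarrow> t 0 | Suc j \<Rightarrow> t (Suc j) - Suc (t j))"
  have nonzero: "\<omega> (t i) \<noteq> 0" for i
    using enumerate_in_set[OF S, of i] by (simp add: S_def t_def)
  have gap: "map \<omega> [m..<n] = replicate (n - m) 0" if "\<And>k. m \<le> k \<Longrightarrow> k < n \<Longrightarrow> \<omega> k = 0" for m n
    by (rule nth_equalityI) (use that in auto)
  have "map \<omega> [0..<Suc (t l)] = block_prefix e a l" for l
  proof (induction l)
    case 0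
    have "\<omega> k = 0" if "k < t 0" for k
      using that not_less_Least[of k "\<lambda>n. n \<in> S"] by (auto simp: t_def enumerate_0 S_def)
    then have "map \<omega> [0..<t 0] = replicate (t 0) 0" using gap[of 0 "t 0"] by simp
    then show ?case by (simp add: block_prefix_def e_def a_def)
  next
    case (Suc l)
    have lt: "t l < t (Suc l)" using enumerate_step[OF S] by (simp add: t_def)
    have "\<omega> k = 0" if "Suc (t l) \<le> k" "k < t (Suc l)" for k
    proof (rule ccontr)
      assume "\<omega> k \<noteq> 0"
      then have "t (Suc l) \<le> k"
        using that S unfolding t_def by (subst enumerate_Suc'') (auto intro: Least_le simp: S_def)
      then show False using that by simp
    qed
    then have zeros: "map \<omega> [Suc (t l)..<t (Suc l)] = replicate (e (Suc l)) 0"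
      using gap by (simp add: e_def)
    have "[0..<t (Suc l)] = [0..<Suc (t l)] @ [Suc (t l)..<t (Suc l)]"
      using lt upt_add_eq_append[of 0 "Suc (t l)" "t (Suc l) - Suc (t l)"] by simp
    then have "map \<omega> [0..<Suc (t (Suc l))]
        = map \<omega> [0..<Suc (t l)] @ map \<omega> [Suc (t l)..<t (Suc l)] @ [\<omega> (t (Suc l))]"
      by simp
    then show ?case unfolding Suc.IH zeros block_prefix_Suc by (simp add: a_def)
  qed
  then have "map \<omega> [0..<length (block_prefix e a l)] = block_prefix e a l" for l
    by (metis length_map length_upt minus_nat.diff_0)
  then have "zero_blocks \<omega> e a" using nonzero by (simp add: zero_blocks_def a_def)
  then show ?thesis by blast
qed

theorem mainTheorem2:
  fixes lam x :: real
  assumes "0 < lam" and "lam < 2" and "0 \<le> x"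
  shows "(\<lambda>n. left_endpoint lam (map (coding lam x) [0..<Suc n])) \<longlonglongrightarrow> x \<and>
         (infinite {n. coding lam x n \<noteq> 0} \<longrightarrow>
            (\<exists>e a. zero_blocks (coding lam x) e a) \<and>
            (\<forall>e a. zero_blocks (coding lam x) e a \<longrightarrow>
               (\<lambda>l. lam_cfrac lam (cfrac_digits e a l)) \<longlonglongrightarrow> x))"
proof (intro conjI impI allI)
  note lim = left_endpoint_tendsto[OF assms]
  show "(\<lambda>n. left_endpoint lam (map (coding lam x) [0..<Suc n])) \<longlonglongrightarrow> x"
    using lim by (rule LIMSEQ_Suc)
  show "\<exists>e a. zero_blocks (coding lam x) e a" if "infinite {n. coding lam x n \<noteq> 0}"
    using zero_blocks_exist[OF that] .
  fix e a assume "zero_blocks (coding lam x) e a"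
  then have pos: "\<And>i. 0 < a i"
    and pre: "\<And>l. block_prefix e a l = map (coding lam x) [0..<length (block_prefix e a l)]"
    by (auto simp: zero_blocks_def)
  have "lam_cfrac lam (cfrac_digits e a l)
      = left_endpoint lam (map (coding lam x) [0..<length (block_prefix e a l)])" for l
    using lam_cfrac_eq_left_endpoint[OF assms(1,2) pos, where e = e and l = l]
      admissible_coding_prefix[OF assms, of "length (block_prefix e a l)"]
    unfolding pre[of l, symmetric] by simp
  moreover have "filterlim (\<lambda>l. length (block_prefix e a l)) at_top sequentially"
    by (intro filterlim_at_top_mono[OF filterlim_ident] always_eventually allI length_block_prefix_ge)
  ultimately show "(\<lambda>l. lam_cfrac lam (cfrac_digits e a l)) \<longlonglongrightarrow> x"
    using filterlim_compose[OF lim] by simp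
qed

end
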